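(* Let $G$ be a locally compact Hausdorff group with left Haar measure $\mu$, let $1\leqslant p<\infty$, and let $\mathcal{F}\subset L^p(G)$ be $L^p$-bounded, i.e. there exists $M>0$ such that $\|f\|_p\leqslant M$ for all $f\in\mathcal{F}$. If $\phi\in C_c(G)$, then $\mathcal{F}\star\phi:=\{f\star\phi : f\in\mathcal{F}\}$ is contained in $C^b(G)$ and is bounded in $C^b(G)$ (with respect to the supremum norm).
   Context: $\mu$ is a left Haar measure on $G$: a nonzero left-invariant Borel measure, finite on compact sets, inner regular on open sets and outer regular on measurable sets; $dy$ denotes integration with respect to $\mu$. $L^p(G)=L^p(G,\mu)$ (complex-valued functions) with norm $\|\cdot\|_p$. $C_c(G)$ is the space of continuous complex-valued functions with compact support; $C^b(G)$ is the Banach space of continuous bounded functions on $G$ with the supremum norm. Convolution: $f\star\phi(x)=\int_G f(y)\,\phi(y^{-1}x)\,dy$ for $x\in G$. *)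

theory Defs
  imports "HOL-Analysis.Analysis"
begin

text \<open>
  Topological groups are written additively, as in the class \<open>topological_group_add\<close>, which does
  not assume commutativity: \<open>x + y\<close> stands for the product $xy$ and \<open>- x\<close> for the inverse $x^{-1}$.
\<close>

definition left_haar_measure :: "'a::topological_group_add measure \<Rightarrow> bool" where
  "left_haar_measure \<mu> \<longleftrightarrow>
     sets \<mu> = sets borel \<and>
     emeasure \<mu> UNIV \<noteq> 0 \<and>
     (\<forall>g. \<forall>A\<in>sets borel. emeasure \<mu> ((\<lambda>x. g + x) ` A) = emeasure \<mu> A) \<and>
     (\<forall>K. compact K \<longrightarrow> emeasure \<mu> K < \<infinity>) \<and>
     (\<forall>U. open U \<longrightarrow> emeasure \<mu> U = (SUP K\<in>{K. compact K \<and> K \<subseteq> U}. emeasure \<mu> K)) \<and>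
     (\<forall>A\<in>sets borel. emeasure \<mu> A = (INF U\<in>{U. open U \<and> A \<subseteq> U}. emeasure \<mu> U))"

text \<open>
  Elements of $L^p$ are represented by measurable functions rather than by almost-everywhere
  classes; accordingly \<open>Lp_norm\<close> is only a seminorm on \<open>Lp_space\<close>.
\<close>

definition Lp_space :: "real \<Rightarrow> 'a measure \<Rightarrow> ('a \<Rightarrow> complex) set" where
  "Lp_space p M = {f \<in> borel_measurable M. integrable M (\<lambda>x. norm (f x) powr p)}"

definition Lp_norm :: "real \<Rightarrow> 'a measure \<Rightarrow> ('a \<Rightarrow> complex) \<Rightarrow> real" where
  "Lp_norm p M f = (\<integral>x. norm (f x) powr p \<partial>M) powr (1 / p)"

definition Cc :: "('a::topological_space \<Rightarrow> complex) set" where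
  "Cc = {\<phi>. continuous_on UNIV \<phi> \<and> compact (closure {x. \<phi> x \<noteq> 0})}"

definition convolution ::
  "'a::topological_group_add measure \<Rightarrow> ('a \<Rightarrow> complex) \<Rightarrow> ('a \<Rightarrow> complex) \<Rightarrow> 'a \<Rightarrow> complex" where
  "convolution \<mu> f \<phi> x = (\<integral>y. f y * \<phi> (- y + x) \<partial>\<mu>)"

text \<open>
  The Bochner integral of a non-integrable function is 0 by convention. The next two lemmas show
  that the convention plays no role for \<open>convolution\<close> on $L^p \times C_c$, and that the choice of
  representative of an $L^p$ class does not matter.
\<close>

lemma convolution_integrable:
  fixes \<mu> :: "'a::{topological_group_add,t2_space} measure"
  assumes \<mu>: "left_haar_measure \<mu>" and p: "1 \<le> p"
    and f: "f \<in> Lp_space p \<mu>" and \<phi>: "\<phi> \<in> Cc"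
  shows "integrable \<mu> (\<lambda>y. f y * \<phi> (- y + x))"
proof -
  define K where "K = closure {z. \<phi> z \<noteq> 0}"
  define K' where "K' = (\<lambda>z. x - z) ` K"
  have sets: "sets \<mu> = sets borel"
    using \<mu> by (simp add: left_haar_measure_def)
  have cont: "continuous_on UNIV \<phi>" and K: "compact K"
    using \<phi> by (auto simp: Cc_def K_def)
  have K': "compact K'"
    unfolding K'_def by (intro compact_continuous_image continuous_intros K)
  then have K'_fin: "emeasure \<mu> K' < \<infinity>"
    using \<mu> by (simp add: left_haar_measure_def)
  have K'_sets: "K' \<in> sets \<mu>"
    unfolding sets using K' by (simp add: borel_closed compact_imp_closed)
  have "bounded (\<phi> ` K)"
    by (intro compact_imp_bounded compact_continuous_image K continuous_on_subset[OF cont]) auto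
  then obtain B where B: "B > 0" "\<And>z. z \<in> K \<Longrightarrow> norm (\<phi> z) \<le> B"
    unfolding bounded_pos by blast
  have vanish: "\<phi> (- y + x) = 0" if "y \<notin> K'" for y
  proof (rule ccontr)
    assume "\<phi> (- y + x) \<noteq> 0"
    then have "- y + x \<in> K"
      unfolding K_def using closure_subset[of "{z. \<phi> z \<noteq> 0}"] by auto
    then have "x - (- y + x) \<in> K'"
      unfolding K'_def by blast
    moreover have "x - (- y + x) = y"
      by (subst diff_conv_add_uminus, subst minus_add) simp
    ultimately show False
      using that by simp
  qed
  have "continuous_on UNIV (\<lambda>y. \<phi> (- y + x))"
    by (rule continuous_on_compose2[OF cont]) (auto intro!: continuous_intros)
  then have "(\<lambda>y. \<phi> (- y + x)) \<in> borel_measurable \<mu>"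
    using borel_measurable_continuous_onI measurable_cong_sets[OF sets refl] by blast
  moreover have "f \<in> borel_measurable \<mu>" and fp: "integrable \<mu> (\<lambda>y. norm (f y) powr p)"
    using f by (auto simp: Lp_space_def)
  ultimately have meas: "(\<lambda>y. f y * \<phi> (- y + x)) \<in> borel_measurable \<mu>"
    by simp
  have dom: "integrable \<mu> (\<lambda>y. B * (norm (f y) powr p + indicator K' y))"
    using fp K'_sets K'_fin by (intro integrable_mult_right Bochner_Integration.integrable_add) auto
  have bound: "norm (f y * \<phi> (- y + x)) \<le> B * (norm (f y) powr p + indicator K' y)" for y
  proof (cases "y \<in> K'")
    case True
    then obtain z where "z \<in> K" "y = x - z"
      unfolding K'_def by blast
    then have "norm (\<phi> (- y + x)) \<le> B"
      using B(2) by simp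
    moreover have "norm (f y) \<le> norm (f y) powr p + 1"
    proof (cases "norm (f y) \<le> 1")
      case False
      then have "norm (f y) powr 1 \<le> norm (f y) powr p"
        using p by (intro powr_mono) auto
      then show ?thesis by simp
    qed (simp add: add_increasing)
    ultimately have "norm (f y) * norm (\<phi> (- y + x)) \<le> (norm (f y) powr p + 1) * B"
      by (intro mult_mono) auto
    then show ?thesis
      using True by (simp add: norm_mult mult.commute)
  qed (use B vanish in auto)
  show ?thesis
    by (rule Bochner_Integration.integrable_bound[OF dom meas])
       (use bound in \<open>auto intro!: order_trans[OF _ abs_ge_self]\<close>)
qed

lemma convolution_cong_AE:
  fixes \<mu> :: "'a::{topological_group_add,t2_space} measure"
  assumes "left_haar_measure \<mu>" "1 \<le> p" "f \<in> Lp_space p \<mu>" "g \<in> Lp_space p \<mu>" "\<phi> \<in> Cc"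
    and eq: "AE y in \<mu>. f y = g y"
  shows "convolution \<mu> f \<phi> = convolution \<mu> g \<phi>"
proof
  fix x
  have "AE y in \<mu>. f y * \<phi> (- y + x) = g y * \<phi> (- y + x)"
    using eq by eventually_elim simp
  then show "convolution \<mu> f \<phi> x = convolution \<mu> g \<phi> x"
    unfolding convolution_def using convolution_integrable assms
    by (intro integral_cong_AE borel_measurable_integrable) blast+
qed

end

theory Submission
  imports Defs
begin

text \<open>
  Both claims come from one estimate. Since \<open>t \<le> t\<^sup>p + 1\<close> for \<open>t \<ge> 0\<close> and \<open>p \<ge> 1\<close>, a function \<open>f\<close>
  in \<open>L\<^sup>p\<close> is integrable over every set \<open>L\<close> of finite measure, with
  \<open>\<integral>\<^sub>L \<bar>f\<bar> \<le> \<parallel>f\<parallel>\<^sup>p + \<mu>(L)\<close>; hence a factor \<open>h\<close> that is bounded by \<open>e\<close> and vanishes off \<open>L\<close>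
  gives \<open>\<bar>\<integral> f h\<bar> \<le> e (\<parallel>f\<parallel>\<^sup>p + \<mu>(L))\<close> (\<open>norm_integral_mult_le\<close>). This elementary substitute for
  Hoelder's inequality is enough, because only uniformity in \<open>f\<close> and \<open>x\<close> matters and not the best
  constant.

  Boundedness: for fixed \<open>x\<close> the kernel \<open>y \<mapsto> \<phi> (- y + x)\<close> vanishes off \<open>x - K\<close>, where \<open>K\<close> is the
  support of \<open>\<phi>\<close>. This set is the left translate by \<open>x\<close> of \<open>- K\<close>, so by left invariance its
  measure does not depend on \<open>x\<close>, and the estimate with \<open>e = sup \<bar>\<phi>\<bar>\<close> is uniform in \<open>x\<close> as well
  as in \<open>f\<close> (\<open>norm_convolution_le\<close>).

  Continuity at \<open>x\<^sub>0\<close>: let \<open>W\<close> be a compact neighbourhood of \<open>x\<^sub>0\<close>. For all \<open>x \<in> W\<close> the kernels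
  vanish off the single compact set \<open>W - K\<close>, and by compactness of that set they converge uniformly
  on it as \<open>x\<close> tends to \<open>x\<^sub>0\<close>. The estimate applied to the difference of two kernels, with \<open>e\<close>
  arbitrarily small, gives the claim (\<open>continuous_on_convolution\<close>).
\<close>

lemma le_powr_add_one:
  fixes t p :: real
  assumes "0 \<le> t" "1 \<le> p"
  shows "t \<le> t powr p + 1"
proof (cases "t \<le> 1")
  case False
  then have "t powr 1 \<le> t powr p"
    using assms by (intro powr_mono) auto
  then show ?thesis
    using assms by simp
qed (simp add: add_increasing)

lemma norm_integral_mult_le:
  fixes f h :: "'a \<Rightarrow> complex"
  assumes f: "f \<in> Lp_space p M" and p: "1 \<le> p"
    and L: "L \<in> sets M" "emeasure M L < \<infinity>"
    and e: "0 \<le> e" and h: "\<And>y. y \<in> L \<Longrightarrow> norm (h y) \<le> e" "\<And>y. y \<notin> L \<Longrightarrow> h y = 0"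
  shows "norm (\<integral>y. f y * h y \<partial>M) \<le> e * ((\<integral>y. norm (f y) powr p \<partial>M) + measure M L)"
proof -
  have fp: "integrable M (\<lambda>y. norm (f y) powr p)"
    using f by (simp add: Lp_space_def)
  have ind: "integrable M (indicator L :: 'a \<Rightarrow> real)"
    using L by simp
  have bound: "norm (f y * h y) \<le> e * (norm (f y) powr p + indicator L y)" for y
  proof (cases "y \<in> L")
    case True
    have "norm (f y) * norm (h y) \<le> (norm (f y) powr p + 1) * e"
      using le_powr_add_one[OF norm_ge_zero p] h(1)[OF True] by (intro mult_mono) auto
    then show ?thesis
      using True by (simp add: norm_mult mult.commute)
  qed (use h(2) e in simp)
  have "norm (\<integral>y. f y * h y \<partial>M) \<le> (\<integral>y. norm (f y * h y) \<partial>M)"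
    by (rule integral_norm_bound)
  also have "\<dots> \<le> (\<integral>y. e * (norm (f y) powr p + indicator L y) \<partial>M)"
    using fp ind bound e by (intro integral_mono') auto
  also have "\<dots> = e * ((\<integral>y. norm (f y) powr p \<partial>M) + measure M L)"
    using fp ind L sets.sets_into_space[OF L(1)] by (simp add: Int_absorb1)
  finally show ?thesis .
qed

text \<open>
  This locates the support of the kernel: \<open>- y + x \<in> K\<close> forces \<open>y = x - (- y + x) \<in> W - K\<close>.
  Taking \<open>W\<close> to be a single point serves for boundedness, a neighbourhood for continuity.
\<close>

lemma kernel_eq_0:
  fixes \<phi> :: "'a::group_add \<Rightarrow> complex"
  assumes K: "{z. \<phi> z \<noteq> 0} \<subseteq> K" and x: "x \<in> W" and y: "y \<notin> (\<lambda>(w, z). w - z) ` (W \<times> K)"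
  shows "\<phi> (- y + x) = 0"
proof (rule ccontr)
  assume "\<phi> (- y + x) \<noteq> 0"
  then have "(x, - y + x) \<in> W \<times> K"
    using K x by auto
  moreover have "y = (\<lambda>(w, z). w - z) (x, - y + x)"
    by (simp add: diff_conv_add_uminus minus_add del: add_uminus_conv_diff)
  ultimately show False
    using y by blast
qed

lemma compact_diff_image:
  fixes W K :: "'a::topological_group_add set"
  assumes "compact W" "compact K"
  shows "compact ((\<lambda>(w, z). w - z) ` (W \<times> K))"
  unfolding case_prod_unfold
  by (intro compact_continuous_image compact_Times assms continuous_intros)

lemma left_haar_measure_compact:
  fixes \<mu> :: "'a::{topological_group_add,t2_space} measure"
  assumes "left_haar_measure \<mu>" "compact L"
  shows "L \<in> sets \<mu>" "emeasure \<mu> L < \<infinity>"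
  using assms by (auto simp: left_haar_measure_def borel_closed compact_imp_closed)

lemma measure_translate_uminus:
  fixes \<mu> :: "'a::{topological_group_add,t2_space} measure"
  assumes \<mu>: "left_haar_measure \<mu>" and K: "compact K"
  shows "measure \<mu> ((\<lambda>(w, z). w - z) ` ({x} \<times> K)) = measure \<mu> (uminus ` K)"
proof -
  have "compact (uminus ` K)"
    by (intro compact_continuous_image K continuous_intros)
  then have "uminus ` K \<in> sets borel"
    by (simp add: borel_closed compact_imp_closed)
  moreover have "(\<lambda>(w, z). w - z) ` ({x} \<times> K) = (\<lambda>z. x + z) ` uminus ` K"
    by (force simp: image_iff)
  ultimately show ?thesis
    using \<mu> by (simp add: left_haar_measure_def measure_def)
qed

lemma Cc_bounded:
  assumes "\<phi> \<in> Cc"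
  obtains B where "0 < B" "\<And>z. norm (\<phi> z) \<le> B"
proof -
  let ?K = "closure {z. \<phi> z \<noteq> 0}"
  have "continuous_on ?K \<phi>" "compact ?K"
    using assms by (auto simp: Cc_def intro: continuous_on_subset)
  then have "bounded (\<phi> ` ?K)"
    by (intro compact_imp_bounded compact_continuous_image)
  then obtain B where B: "B > 0" "\<And>z. z \<in> ?K \<Longrightarrow> norm (\<phi> z) \<le> B"
    unfolding bounded_pos by blast
  have "norm (\<phi> z) \<le> B" for z
    using B closure_subset[of "{z. \<phi> z \<noteq> 0}"] by (cases "\<phi> z = 0") auto
  then show ?thesis
    using that B(1) by blast
qed

text \<open>
  The point of this bound is that its right-hand side is free of \<open>x\<close> and depends on \<open>f\<close> only
  through the integral of \<open>\<bar>f\<bar>\<^sup>p\<close>.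
\<close>

lemma norm_convolution_le:
  fixes \<mu> :: "'a::{topological_group_add,t2_space} measure"
  assumes \<mu>: "left_haar_measure \<mu>" and p: "1 \<le> p" and f: "f \<in> Lp_space p \<mu>"
    and K: "compact K" "{z. \<phi> z \<noteq> 0} \<subseteq> K" and B: "0 \<le> B" "\<And>z. norm (\<phi> z) \<le> B"
  shows "norm (convolution \<mu> f \<phi> x)
           \<le> B * ((\<integral>y. norm (f y) powr p \<partial>\<mu>) + measure \<mu> (uminus ` K))"
proof -
  let ?L = "(\<lambda>(w, z). w - z) ` ({x} \<times> K)"
  have L: "compact ?L"
    by (intro compact_diff_image K) simp
  have "norm (\<integral>y. f y * \<phi> (- y + x) \<partial>\<mu>) \<le> B * ((\<integral>y. norm (f y) powr p \<partial>\<mu>) + measure \<mu> ?L)"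
    by (rule norm_integral_mult_le[OF f p left_haar_measure_compact[OF \<mu> L] B(1)])
       (use B(2) kernel_eq_0[OF K(2), of x "{x}"] in blast)+
  then show ?thesis
    unfolding convolution_def measure_translate_uminus[OF \<mu> K(1)] .
qed

lemma continuous_on_convolution:
  fixes \<mu> :: "'a::{topological_group_add,t2_space} measure"
  assumes lc: "locally_compact_space (euclidean :: 'a topology)"
    and \<mu>: "left_haar_measure \<mu>" and p: "1 \<le> p" and f: "f \<in> Lp_space p \<mu>" and \<phi>: "\<phi> \<in> Cc"
  shows "continuous_on UNIV (convolution \<mu> f \<phi>)"
proof -
  have "(convolution \<mu> f \<phi> \<longlongrightarrow> convolution \<mu> f \<phi> x0) (at x0)" for x0
  proof (rule tendstoI)
    fix \<epsilon> :: real
    assume \<epsilon>: "0 < \<epsilon>"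
    define K where "K = closure {z. \<phi> z \<noteq> 0}"
    have K: "compact K" "{z. \<phi> z \<noteq> 0} \<subseteq> K" and cont: "continuous_on UNIV \<phi>"
      using \<phi> closure_subset[of "{z. \<phi> z \<noteq> 0}"] by (auto simp: Cc_def K_def)
    obtain U W where U: "open U" "x0 \<in> U" "U \<subseteq> W" and W: "compact W"
      using lc unfolding locally_compact_space_def by simp meson
    define L where "L = (\<lambda>(w, z). w - z) ` (W \<times> K)"
    have L: "compact L"
      unfolding L_def by (intro compact_diff_image W K)
    define C where "C = (\<integral>y. norm (f y) powr p \<partial>\<mu>) + measure \<mu> L"
    have C: "0 \<le> C"
      unfolding C_def by (intro add_nonneg_nonneg integral_nonneg) auto
    \<comment> \<open>\<open>C\<close> may vanish, and the final inequality has to be strict; hence the summand 1.\<close>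
    define e where "e = \<epsilon> / (C + 1)"
    have e: "0 < e" and eC: "e * C < \<epsilon>"
      using \<epsilon> C by (auto simp: e_def field_simps)
    have "continuous_on (UNIV \<times> L) (\<lambda>q. \<phi> (- snd q + fst q))"
      by (rule continuous_on_compose2[OF cont]) (auto intro!: continuous_intros)
    then obtain V where V: "open V" "x0 \<in> V"
      and close: "\<And>x y. x \<in> V \<Longrightarrow> y \<in> L \<Longrightarrow> dist (\<phi> (- y + x)) (\<phi> (- y + x0)) \<le> e"
      by (rule continuous_on_prod_compactE[OF _ L, of UNIV _ x0 e]) (use e in auto)
    have "dist (convolution \<mu> f \<phi> x) (convolution \<mu> f \<phi> x0) < \<epsilon>" if x: "x \<in> U \<inter> V" for x
    proof -
      have int: "integrable \<mu> (\<lambda>y. f y * \<phi> (- y + x))" for x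
        by (rule convolution_integrable[OF \<mu> p f \<phi>])
      have "convolution \<mu> f \<phi> x - convolution \<mu> f \<phi> x0
              = (\<integral>y. f y * (\<phi> (- y + x) - \<phi> (- y + x0)) \<partial>\<mu>)"
        unfolding convolution_def right_diff_distrib
        by (rule Bochner_Integration.integral_diff[OF int int, symmetric])
      moreover have "norm (\<integral>y. f y * (\<phi> (- y + x) - \<phi> (- y + x0)) \<partial>\<mu>) \<le> e * C"
        unfolding C_def
      proof (rule norm_integral_mult_le[OF f p left_haar_measure_compact[OF \<mu> L]])
        show "norm (\<phi> (- y + x) - \<phi> (- y + x0)) \<le> e" if "y \<in> L" for y
          using close[of x y] x that by (simp add: dist_norm)
        show "\<phi> (- y + x) - \<phi> (- y + x0) = 0" if "y \<notin> L" for y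
          using that x U kernel_eq_0[OF K(2), of _ W y] unfolding L_def by (auto simp: subset_iff)
      qed (use e in simp)
      ultimately show ?thesis
        using eC by (simp add: dist_norm)
    qed
    then show "\<forall>\<^sub>F x in at x0. dist (convolution \<mu> f \<phi> x) (convolution \<mu> f \<phi> x0) < \<epsilon>"
      using U V by (intro eventually_at_topological[THEN iffD2] exI[of _ "U \<inter> V"]) auto
  qed
  then show ?thesis
    by (simp add: continuous_on_def)
qed

theorem theorem6:
  fixes \<mu> :: "'a::{topological_group_add, t2_space} measure"
    and p :: real
    and F :: "('a \<Rightarrow> complex) set"
    and \<phi> :: "'a \<Rightarrow> complex"
  assumes "locally_compact_space (euclidean :: 'a topology)"
    and "left_haar_measure \<mu>"
    and "1 \<le> p"
    and "F \<subseteq> Lp_space p \<mu>"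
    and "\<exists>M>0. \<forall>f\<in>F. Lp_norm p \<mu> f \<le> M"
    and "\<phi> \<in> Cc"
  shows "(\<lambda>f. convolution \<mu> f \<phi>) ` F \<subseteq> bcontfun \<and>
         bounded (Bcontfun ` ((\<lambda>f. convolution \<mu> f \<phi>) ` F))"
proof -
  obtain M where M: "0 < M" "\<And>f. f \<in> F \<Longrightarrow> Lp_norm p \<mu> f \<le> M"
    using assms(5) by blast
  obtain B where B: "0 < B" "\<And>z. norm (\<phi> z) \<le> B"
    using Cc_bounded[OF assms(6)] by blast
  define K where "K = closure {z. \<phi> z \<noteq> 0}"
  have K: "compact K" "{z. \<phi> z \<noteq> 0} \<subseteq> K"
    using assms(6) closure_subset[of "{z. \<phi> z \<noteq> 0}"] by (auto simp: Cc_def K_def)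
  define R where "R = B * (M powr p + measure \<mu> (uminus ` K))"
  have R: "norm (convolution \<mu> f \<phi> x) \<le> R" if "f \<in> F" for f x
  proof -
    have "(\<integral>y. norm (f y) powr p \<partial>\<mu>) = Lp_norm p \<mu> f powr p"
      using assms(3) by (simp add: Lp_norm_def powr_powr integral_nonneg)
    also have "\<dots> \<le> M powr p"
      using M(2)[OF that] assms(3) by (intro powr_mono2) (auto simp: Lp_norm_def)
    finally have "B * ((\<integral>y. norm (f y) powr p \<partial>\<mu>) + measure \<mu> (uminus ` K)) \<le> R"
      unfolding R_def using B(1) by (intro mult_left_mono) auto
    moreover have "f \<in> Lp_space p \<mu>"
      using assms(4) that by blast
    ultimately show ?thesis
      using norm_convolution_le[OF assms(2,3) _ K less_imp_le[OF B(1)] B(2)] order_trans by blast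
  qed
  have bc: "convolution \<mu> f \<phi> \<in> bcontfun" if "f \<in> F" for f
    using continuous_on_convolution[OF assms(1-3) _ assms(6)] assms(4) R[OF that] that
    by (intro bcontfun_normI) auto
  have "norm (Bcontfun (convolution \<mu> f \<phi>)) \<le> R" if "f \<in> F" for f
    using R[OF that] by (intro norm_bound) (simp add: Bcontfun_inverse[OF bc[OF that]])
  then have "bounded (Bcontfun ` ((\<lambda>f. convolution \<mu> f \<phi>) ` F))"
    unfolding bounded_iff by blast
  then show ?thesis
    using bc by blast
qed

end
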